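(* Let $f\in K^{\times}$ be an iterated integral over $k$ and let $g\in K$ satisfy a nonzero homogeneous linear differential equation with coefficients in $k$. Assume that $k$ contains an element $x$ with $x'=1$, that $f$ is transcendental over $k$, and that $f$ and $g$ are algebraically dependent over $k$. Then $g\in k[f]$.
   Context: $K$ is a differential field of characteristic zero (derivation $y\mapsto y'$), $k\subset K$ is an algebraically closed differential subfield, and $K$ and $k$ have the same field of constants $C$. An element $f\in K$ is an iterated integral over $k$ if $f^{(n)}\in k$ for some $n\in\mathbb{N}$. *)

theory Defs
  imports "HOL-Computational_Algebra.Polynomial"
begin

text \<open>A differential field K is modelled as a type 'a of class field_char_0
  (characteristic zero) together with a derivation D.\<close>

definition derivation :: "('a::field \<Rightarrow> 'a) \<Rightarrow> bool" where
  "derivation D \<longleftrightarrow> (\<forall>a b. D (a + b) = D a + D b) \<and> (\<forall>a b. D (a * b) = D a * b + a * D b)"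

definition subfield :: "'a::field set \<Rightarrow> bool" where
  "subfield k \<longleftrightarrow> 0 \<in> k \<and> 1 \<in> k \<and> (\<forall>a\<in>k. \<forall>b\<in>k. a + b \<in> k \<and> a * b \<in> k)
     \<and> (\<forall>a\<in>k. - a \<in> k) \<and> (\<forall>a\<in>k. a \<noteq> 0 \<longrightarrow> inverse a \<in> k)"

definition differential_subfield :: "('a::field \<Rightarrow> 'a) \<Rightarrow> 'a set \<Rightarrow> bool" where
  "differential_subfield D k \<longleftrightarrow> subfield k \<and> (\<forall>a\<in>k. D a \<in> k)"

definition poly_over :: "'a::zero set \<Rightarrow> 'a poly \<Rightarrow> bool" where
  "poly_over k p \<longleftrightarrow> (\<forall>i. coeff p i \<in> k)"

definition algebraically_closed_subfield :: "'a::field set \<Rightarrow> bool" where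
  "algebraically_closed_subfield k \<longleftrightarrow> subfield k \<and>
     (\<forall>p. poly_over k p \<and> degree p > 0 \<longrightarrow> (\<exists>r\<in>k. poly p r = 0))"

definition constants :: "('a::field \<Rightarrow> 'a) \<Rightarrow> 'a set" where
  "constants D = {c. D c = 0}"

definition iterated_integral :: "('a::field \<Rightarrow> 'a) \<Rightarrow> 'a set \<Rightarrow> 'a \<Rightarrow> bool" where
  "iterated_integral D k f \<longleftrightarrow> (\<exists>n. (D ^^ n) f \<in> k)"

definition satisfies_lin_ode :: "('a::field \<Rightarrow> 'a) \<Rightarrow> 'a set \<Rightarrow> 'a \<Rightarrow> bool" where
  "satisfies_lin_ode D k g \<longleftrightarrow> (\<exists>n a. (\<forall>i\<le>n. a i \<in> k) \<and> (\<exists>i\<le>n. a i \<noteq> 0)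
      \<and> (\<Sum>i\<le>n. a i * (D ^^ i) g) = 0)"

definition transcendental_over :: "'a::field set \<Rightarrow> 'a \<Rightarrow> bool" where
  "transcendental_over k f \<longleftrightarrow> (\<forall>p. poly_over k p \<and> poly p f = 0 \<longrightarrow> p = 0)"

text \<open>Bivariate polynomials over k are represented as 'a poly poly
  (polynomials in X whose coefficients are polynomials in Y);
  evaluation at (f, g) substitutes X := f and Y := g.\<close>
definition eval2 :: "'a::comm_ring_1 poly poly \<Rightarrow> 'a \<Rightarrow> 'a \<Rightarrow> 'a" where
  "eval2 P f g = poly (map_poly (\<lambda>q. poly q g) P) f"

definition algebraically_dependent_over :: "'a::field set \<Rightarrow> 'a \<Rightarrow> 'a \<Rightarrow> bool" where
  "algebraically_dependent_over k f g \<longleftrightarrow>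
     (\<exists>P. P \<noteq> 0 \<and> (\<forall>i. poly_over k (coeff P i)) \<and> eval2 P f g = 0)"

definition in_poly_ring :: "'a::field set \<Rightarrow> 'a \<Rightarrow> 'a \<Rightarrow> bool" where
  "in_poly_ring k f g \<longleftrightarrow> (\<exists>p. poly_over k p \<and> g = poly p f)"

end

theory Submission
  imports Defs
begin

text \<open>
  The key is a derivation \<open>\<delta>\<close> of the field that kills \<open>k\<close>, commutes with \<open>D\<close> on everything
  in sight, and has \<open>\<delta> f\<close> a nonzero element of \<open>k\<close>. Thanks to \<open>x\<close>, partial Taylor sums show that
  \<open>f\<close> is a \<open>k\<close>-linear combination of elements \<open>h\<^sub>i\<close> with \<open>D h\<^sub>i \<in> k\<close>. The vectors \<open>(\<delta> h\<^sub>i)\<close>, for \<open>\<delta>\<close>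
  ranging over all derivations killing \<open>k\<close>, form a \<open>D\<close>-stable subspace, which is therefore spanned
  by constant vectors; one of these yields \<open>\<delta>\<close>.

  Since \<open>\<delta>\<close> preserves the solutions of the linear equation of \<open>g\<close>, which form a finite-dimensional
  space over the constants, \<open>g\<close> is annihilated by a polynomial in \<open>\<delta>\<close> with constant coefficients.
  It splits over \<open>k\<close>. Among the elements algebraic over \<open>k(f)\<close>, \<open>\<delta>\<close> has kernel \<open>k\<close> and no nonzero
  eigenvalue, and \<open>\<delta> - r\<close> is surjective on \<open>k[f]\<close>, so peeling off the linear factors one
  by one gives \<open>g \<in> k[f]\<close>.

  Algebraic closure is handled through derivations: the elements algebraic over \<open>k(S)\<close> are those
  killed by every derivation that kills \<open>k\<close> and \<open>S\<close>.
\<close>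

section \<open>Derivations\<close>

lemma derivation_add: "derivation D \<Longrightarrow> D (a + b) = D a + D b"
  and derivation_mult: "derivation D \<Longrightarrow> D (a * b) = D a * b + a * D b"
  by (auto simp: derivation_def)

lemma derivation_0: "derivation D \<Longrightarrow> D 0 = 0"
  using derivation_add[of D 0 0] by (metis add_cancel_right_right add.right_neutral)

lemma derivation_1: "derivation D \<Longrightarrow> D 1 = 0"
  using derivation_mult[of D 1 1] by (metis add_cancel_right_right mult.right_neutral mult_1)

lemma derivation_minus: "derivation D \<Longrightarrow> D (- a) = - D a"
  using derivation_add[of D a "- a"] by (simp add: derivation_0 eq_neg_iff_add_eq_0 add.commute)

lemma derivation_diff: "derivation D \<Longrightarrow> D (a - b) = D a - D b"
  using derivation_add[of D a "- b"] by (simp add: derivation_minus)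

lemma derivation_sum: "derivation D \<Longrightarrow> D (\<Sum>i\<in>A. F i) = (\<Sum>i\<in>A. D (F i))"
  by (induction A rule: infinite_finite_induct) (simp_all add: derivation_0 derivation_add)

lemma derivation_of_nat: "derivation D \<Longrightarrow> D (of_nat n) = 0"
  by (induction n) (simp_all add: derivation_0 derivation_1 derivation_add)

lemma derivation_poly:
  assumes "derivation D"
  shows "D (poly p u) = poly (map_poly D p) u + poly (pderiv p) u * D u"
proof (induction p)
  case 0
  then show ?case by (simp add: derivation_0[OF assms])
next
  case (pCons a p)
  have "map_poly D (pCons a p) = pCons (D a) (map_poly D p)"
    by (rule poly_eqI) (simp add: coeff_map_poly derivation_0[OF assms] coeff_pCons split: nat.split)
  with pCons show ?case
    by (simp add: derivation_add[OF assms] derivation_mult[OF assms] pderiv_pCons algebra_simps)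
qed

lemma derivation_bracket:
  assumes "derivation D" "derivation \<delta>"
  shows "derivation (\<lambda>u. D (\<delta> u) - \<delta> (D u))"
  using assms
  by (simp add: derivation_def[of "\<lambda>u. D (\<delta> u) - \<delta> (D u)"] derivation_add derivation_mult)
    (simp add: algebra_simps)

section \<open>Derivations that vanish on a set and the closure they define\<close>

definition derivations_killing :: "'a::field set \<Rightarrow> ('a \<Rightarrow> 'a) set" where
  "derivations_killing S = {\<delta>. derivation \<delta> \<and> (\<forall>a\<in>S. \<delta> a = 0)}"

definition derivation_closure :: "'a::field set \<Rightarrow> 'a set" where
  "derivation_closure S = {u. \<forall>\<delta>\<in>derivations_killing S. \<delta> u = 0}"

lemma derivations_killing_scale:
  "\<delta> \<in> derivations_killing S \<Longrightarrow> (\<lambda>u. c * \<delta> u) \<in> derivations_killing S"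
  by (auto simp: derivations_killing_def derivation_def distrib_left mult.assoc mult.left_commute)

lemma derivations_killing_diff:
  "\<delta> \<in> derivations_killing S \<Longrightarrow> \<epsilon> \<in> derivations_killing S \<Longrightarrow>
    (\<lambda>u. \<delta> u - \<epsilon> u) \<in> derivations_killing S"
  by (auto simp: derivations_killing_def derivation_def left_diff_distrib right_diff_distrib)

lemma derivations_killing_bracket:
  assumes "derivation D" "\<delta> \<in> derivations_killing S" "\<And>a. a \<in> S \<Longrightarrow> \<delta> (D a) = 0"
  shows "(\<lambda>u. D (\<delta> u) - \<delta> (D u)) \<in> derivations_killing S"
  using assms derivation_bracket[of D \<delta>] derivation_0[of D]
  by (auto simp: derivations_killing_def)

text \<open>The bracket of \<open>D\<close> with a derivation \<open>\<delta>\<close> killing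
  \<open>S\<close> again kills \<open>S\<close>, hence also \<open>u\<close>; since
  \<open>\<delta> u = 0\<close>, only \<open>\<delta> (D u)\<close> is left of it, up to
  sign.\<close>

lemma derivation_closure_stable:
  assumes D: "derivation D" and S: "\<And>a. a \<in> S \<Longrightarrow> D a \<in> derivation_closure S"
    and u: "u \<in> derivation_closure S"
  shows "D u \<in> derivation_closure S"
  unfolding derivation_closure_def
proof clarify
  fix \<delta> assume \<delta>: "\<delta> \<in> derivations_killing S"
  have "(\<lambda>u. D (\<delta> u) - \<delta> (D u)) \<in> derivations_killing S"
    using D \<delta> S by (intro derivations_killing_bracket) (auto simp: derivation_closure_def)
  then have "D (\<delta> u) - \<delta> (D u) = 0"
    using u by (auto simp: derivation_closure_def)
  moreover have "\<delta> u = 0" using u \<delta> by (auto simp: derivation_closure_def)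
  ultimately show "\<delta> (D u) = 0" by (simp add: derivation_0[OF D])
qed

lemma derivation_closure_superset: "S \<subseteq> derivation_closure S"
  by (auto simp: derivation_closure_def derivations_killing_def)

lemma derivation_closure_ring:
  assumes "u \<in> derivation_closure S" "v \<in> derivation_closure S"
  shows "u - v \<in> derivation_closure S" "u * v \<in> derivation_closure S"
  using assms
  by (auto simp: derivation_closure_def derivations_killing_def derivation_diff derivation_mult)

section \<open>Extending derivations\<close>

text \<open>A partial derivation is encoded by its graph over a subring, which suits unions of
  chains. Closure under differences turns the condition at 0 into single-valuedness.\<close>

definition derivation_graph :: "('a::field \<times> 'a) set \<Rightarrow> bool" where
  "derivation_graph G \<longleftrightarrow> (1, 0) \<in> G
     \<and> (\<forall>a a' b b'. (a, a') \<in> G \<and> (b, b') \<in> G \<longrightarrow> (a - b, a' - b') \<in> G \<and> (a * b, a' * b + a * b') \<in> G)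
     \<and> (\<forall>a'. (0, a') \<in> G \<longrightarrow> a' = 0)"

text \<open>The pair \<open>(p, p')\<close> consists of a polynomial over the domain of \<open>G\<close> and
  the polynomial obtained by applying the derivation to its coefficients.\<close>

definition graph_polys :: "('a::field \<times> 'a) set \<Rightarrow> ('a poly \<times> 'a poly) set" where
  "graph_polys G = {(p, p'). \<forall>i. (coeff p i, coeff p' i) \<in> G}"

text \<open>The value forced at \<open>poly p u\<close> once \<open>u\<close> is sent to
  \<open>w\<close>, when \<open>p'\<close> is \<open>p\<close> with its coefficients differentiated;
  compare \<open>derivation_poly\<close>.\<close>

definition prolong :: "'a::field \<Rightarrow> 'a \<Rightarrow> 'a poly \<Rightarrow> 'a poly \<Rightarrow> 'a" where
  "prolong u w p p' = poly p' u + poly (pderiv p) u * w"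

definition adjoin :: "('a::field \<times> 'a) set \<Rightarrow> 'a \<Rightarrow> 'a \<Rightarrow> ('a \<times> 'a) set" where
  "adjoin G u w = (\<lambda>(p, p'). (poly p u, prolong u w p p')) ` graph_polys G"

lemma prolong_diff: "prolong u w (p - q) (p' - q') = prolong u w p p' - prolong u w q q'"
  by (simp add: prolong_def pderiv_diff algebra_simps)

lemma prolong_mult:
  "prolong u w (p * q) (p' * q + p * q') = prolong u w p p' * poly q u + poly p u * prolong u w q q'"
  by (simp add: prolong_def pderiv_mult algebra_simps)

lemma derivation_graphD:
  assumes "derivation_graph G"
  shows "(1, 0) \<in> G" "(a, a') \<in> G \<Longrightarrow> (b, b') \<in> G \<Longrightarrow> (a - b, a' - b') \<in> G"
    "(a, a') \<in> G \<Longrightarrow> (b, b') \<in> G \<Longrightarrow> (a * b, a' * b + a * b') \<in> G"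
    "(0, a') \<in> G \<Longrightarrow> a' = 0"
  using assms unfolding derivation_graph_def by blast+

lemma derivation_graph_0: "derivation_graph G \<Longrightarrow> (0, 0) \<in> G"
  using derivation_graphD(2)[of G 1 0 1 0] derivation_graphD(1)[of G] by simp

lemma derivation_graph_add:
  assumes G: "derivation_graph G" and "(a, a') \<in> G" "(b, b') \<in> G"
  shows "(a + b, a' + b') \<in> G"
  using derivation_graphD(2)[OF G assms(2) derivation_graphD(2)[OF G derivation_graph_0[OF G] assms(3)]]
  by simp

lemma derivation_graph_sum:
  assumes "derivation_graph G" and "\<And>i. i \<in> A \<Longrightarrow> (F i, F' i) \<in> G"
  shows "((\<Sum>i\<in>A. F i), (\<Sum>i\<in>A. F' i)) \<in> G"
  using assms(2)
  by (induction A rule: infinite_finite_induct)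
    (simp_all add: derivation_graph_0[OF assms(1)] derivation_graph_add[OF assms(1)])

lemma graph_polys_diff:
  assumes "derivation_graph G" "(p, p') \<in> graph_polys G" "(q, q') \<in> graph_polys G"
  shows "(p - q, p' - q') \<in> graph_polys G"
  using assms by (auto simp: graph_polys_def intro: derivation_graphD)

lemma graph_polys_mult:
  assumes "derivation_graph G" "(p, p') \<in> graph_polys G" "(q, q') \<in> graph_polys G"
  shows "(p * q, p' * q + p * q') \<in> graph_polys G"
  using assms
  by (auto simp: graph_polys_def coeff_mult sum.distrib[symmetric]
      intro!: derivation_graph_sum intro: derivation_graphD)

lemma graph_polys_monom:
  assumes "derivation_graph G" "(a, a') \<in> G"
  shows "(monom a n, monom a' n) \<in> graph_polys G"
  using assms by (auto simp: graph_polys_def derivation_graph_0)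

lemma graph_polys_pderiv:
  assumes G: "derivation_graph G" and p: "(p, p') \<in> graph_polys G"
  shows "(pderiv p, pderiv p') \<in> graph_polys G"
proof -
  have "(of_nat n * a, of_nat n * a') \<in> G" if "(a, a') \<in> G" for n a a'
    by (induction n)
      (use that in \<open>simp_all add: derivation_graph_0[OF G] derivation_graph_add[OF G] algebra_simps\<close>)
  then show ?thesis
    using p by (simp add: graph_polys_def coeff_pderiv del: of_nat_Suc)
qed

text \<open>Two representations of an element by polynomials in \<open>u\<close> differ by a
  relation \<open>poly p u = 0\<close>, so \<open>wd\<close> is all that single-valuedness
  requires.\<close>

lemma derivation_graph_adjoin:
  assumes G: "derivation_graph G"
    and wd: "\<And>p p'. (p, p') \<in> graph_polys G \<Longrightarrow> poly p u = 0 \<Longrightarrow> prolong u w p p' = 0"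
  shows "derivation_graph (adjoin G u w)" "G \<subseteq> adjoin G u w" "(u, w) \<in> adjoin G u w"
proof -
  have const: "(a, a') \<in> adjoin G u w" if "(a, a') \<in> G" for a a'
    unfolding adjoin_def
    by (rule image_eqI[OF _ graph_polys_monom[OF G that, of 0]]) (simp add: prolong_def poly_monom pderiv_monom)
  then show "G \<subseteq> adjoin G u w" by auto
  show "(u, w) \<in> adjoin G u w"
    unfolding adjoin_def
    by (rule image_eqI[OF _ graph_polys_monom[OF G derivation_graphD(1)[OF G], of 1]])
      (simp add: prolong_def poly_monom pderiv_monom)
  have diff: "(a - b, a' - b') \<in> adjoin G u w" and mult: "(a * b, a' * b + a * b') \<in> adjoin G u w"
    if a: "(a, a') \<in> adjoin G u w" and b: "(b, b') \<in> adjoin G u w" for a a' b b'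
  proof -
    obtain p p' where p: "(p, p') \<in> graph_polys G" "a = poly p u" "a' = prolong u w p p'"
      using a by (auto simp: adjoin_def)
    obtain q q' where q: "(q, q') \<in> graph_polys G" "b = poly q u" "b' = prolong u w q q'"
      using b by (auto simp: adjoin_def)
    show "(a - b, a' - b') \<in> adjoin G u w"
      unfolding adjoin_def
      by (rule image_eqI[OF _ graph_polys_diff[OF G p(1) q(1)]]) (simp add: p q prolong_diff)
    show "(a * b, a' * b + a * b') \<in> adjoin G u w"
      unfolding adjoin_def
      by (rule image_eqI[OF _ graph_polys_mult[OF G p(1) q(1)]]) (simp add: p q prolong_mult)
  qed
  show "derivation_graph (adjoin G u w)"
    unfolding derivation_graph_def
    using const[OF derivation_graphD(1)[OF G]] diff mult wd
    by (auto simp: adjoin_def)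
qed

text \<open>If \<open>u\<close> satisfies no relation over the domain, any value works. Otherwise a
  relation \<open>q\<close> of least degree dictates \<open>w\<close>, and pseudo-division by
  \<open>q\<close> shows that all other relations are respected.\<close>

lemma derivation_graph_extend:
  fixes u :: "'a::field_char_0"
  assumes G: "derivation_graph G"
  obtains w where "\<And>p p'. (p, p') \<in> graph_polys G \<Longrightarrow> poly p u = 0 \<Longrightarrow> prolong u w p p' = 0"
proof -
  have zero: "p' = 0" if "(0, p') \<in> graph_polys G" for p'
    using that derivation_graphD(4)[OF G] by (auto simp: graph_polys_def poly_eq_iff)
  define Q where "Q = (\<lambda>(p, p'). (p, p') \<in> graph_polys G \<and> p \<noteq> 0 \<and> poly p u = 0)"
  show ?thesis
  proof (cases "\<exists>z. Q z")
    case False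
    have "prolong u 0 p p' = 0" if "(p, p') \<in> graph_polys G" "poly p u = 0" for p p'
      using that False zero by (auto simp: Q_def prolong_def)
    then show ?thesis by (rule that)
  next
    case True
    define z where "z = arg_min (\<lambda>z. degree (fst z)) Q"
    have "Q z"
      using True unfolding z_def by (metis arg_min_natI)
    moreover have min: "degree (fst z) \<le> degree p" if "Q (p, p')" for p p'
      using arg_min_nat_le[of Q "(p, p')" "\<lambda>z. degree (fst z)"] that unfolding z_def by simp
    obtain q q' where z: "z = (q, q')" by force
    ultimately have q: "(q, q') \<in> graph_polys G" "q \<noteq> 0" "poly q u = 0"
      by (auto simp: Q_def)
    have min: "p = 0" if "(p, p') \<in> graph_polys G" "poly p u = 0" "degree p < degree q" for p p'
      using min[of p p'] that by (auto simp: Q_def z)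
    have dq: "degree q > 0"
      by (rule ccontr) (use q in \<open>auto elim!: degree_eq_zeroE\<close>)
    \<comment> \<open>In characteristic zero \<open>pderiv q\<close> is nonzero and of smaller
      degree than \<open>q\<close>, so minimality forbids it to vanish at \<open>u\<close>.\<close>
    have "poly (pderiv q) u \<noteq> 0"
      using min[OF graph_polys_pderiv[OF G q(1)]] dq by (auto simp: degree_pderiv pderiv_eq_0_iff)
    define w where "w = - poly q' u / poly (pderiv q) u"
    have wq: "prolong u w q q' = 0"
      using \<open>poly (pderiv q) u \<noteq> 0\<close> by (simp add: prolong_def w_def)
    have "prolong u w p p' = 0" if "(p, p') \<in> graph_polys G" "poly p u = 0" for p p'
      using that
    proof (induction "degree p" arbitrary: p p' rule: less_induct)
      case less
      show ?case
      proof (cases "degree p < degree q")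
        case True
        then have "p = 0" using min less.prems by blast
        then have "p' = 0" using zero less.prems by blast
        with \<open>p = 0\<close> show ?thesis by (simp add: prolong_def)
      next
        case False
        \<comment> \<open>One step of pseudo-division: \<open>p\<close> is multiplied by the leading
          coefficient of \<open>q\<close> because the domain of \<open>G\<close> is only a ring. The
          primed polynomials carry the derivatives of the coefficients.\<close>
        define c where "c = monom (lead_coeff q) 0"
        define c' where "c' = monom (coeff q' (degree q)) 0"
        define m where "m = monom (lead_coeff p) (degree p - degree q)"
        define m' where "m' = monom (coeff p' (degree p)) (degree p - degree q)"
        have c: "(c, c') \<in> graph_polys G" and m: "(m, m') \<in> graph_polys G"
          unfolding c_def c'_def m_def m'_def using q less.prems
          by (auto intro!: graph_polys_monom[OF G] simp: graph_polys_def derivation_graph_0[OF G])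
        define r where "r = c * p - m * q"
        define r' where "r' = (c' * p + c * p') - (m' * q + m * q')"
        have r: "(r, r') \<in> graph_polys G"
          unfolding r_def r'_def
          by (intro graph_polys_diff graph_polys_mult G c m q less.prems)
        have "coeff r (degree p) = 0"
          using False by (simp add: r_def c_def m_def coeff_monom_mult)
        moreover have "degree r \<le> degree p"
          unfolding r_def
        proof (rule degree_diff_le)
          show "degree (c * p) \<le> degree p"
            by (rule order.trans[OF degree_mult_le]) (simp add: c_def monom_0)
          show "degree (m * q) \<le> degree p"
            using False by (intro order.trans[OF degree_mult_le])
              (use degree_monom_le[of "lead_coeff p" "degree p - degree q"] in \<open>simp add: m_def\<close>)
        qed
        ultimately have "degree r < degree p"
          using dq False by (metis degree_0 leading_coeff_0_iff le_neq_implies_less not_less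
              order.strict_trans2)
        then have "prolong u w r r' = 0"
          using less.hyps[OF _ r] q less.prems by (simp add: r_def)
        \<comment> \<open>By the product rule every other term contains \<open>poly p u\<close>,
          \<open>poly q u\<close> or \<open>prolong u w q q'\<close>, all of which are zero.\<close>
        moreover have "prolong u w r r' = lead_coeff q * prolong u w p p'"
          unfolding r_def r'_def
          by (simp add: prolong_diff prolong_mult wq q less.prems) (simp add: c_def poly_monom)
        ultimately show ?thesis using q by simp
      qed
    qed
    then show ?thesis by (rule that)
  qed
qed

text \<open>Zorn's lemma gives a maximal graph above \<open>G\<close>; it is total, since a missing
  element could be adjoined.\<close>

theorem derivation_extension:
  fixes G :: "('a::field_char_0 \<times> 'a) set"
  assumes G: "derivation_graph G"
  obtains \<delta> where "derivation \<delta>" "\<And>a a'. (a, a') \<in> G \<Longrightarrow> \<delta> a = a'"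
proof -
  define \<A> where "\<A> = {H. derivation_graph H \<and> G \<subseteq> H}"
  have "\<exists>M\<in>\<A>. \<forall>X\<in>\<A>. M \<subseteq> X \<longrightarrow> X = M"
  proof (rule subset_Zorn_nonempty)
    show "\<A> \<noteq> {}" using G by (auto simp: \<A>_def)
  next
    fix C assume C: "C \<noteq> {}" "subset.chain \<A> C"
    have dg: "derivation_graph H" "G \<subseteq> H" if "H \<in> C" for H
      using C(2) that by (auto simp: subset.chain_def \<A>_def)
    have two: "\<exists>H\<in>C. z \<in> H \<and> y \<in> H" if "z \<in> \<Union>C" "y \<in> \<Union>C" for y z
      using C(2) that unfolding subset.chain_def subset_iff by blast
    have "derivation_graph (\<Union>C)"
      unfolding derivation_graph_def
    proof (intro conjI allI impI)
      show "(1, 0) \<in> \<Union>C" using C(1) dg derivation_graphD(1) by blast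
    next
      fix a a' b b' assume "(a, a') \<in> \<Union>C \<and> (b, b') \<in> \<Union>C"
      then obtain H where "H \<in> C" "(a, a') \<in> H" "(b, b') \<in> H" using two by blast
      then show "(a - b, a' - b') \<in> \<Union>C" "(a * b, a' * b + a * b') \<in> \<Union>C"
        using derivation_graphD(2,3)[OF dg(1)] by blast+
    next
      fix a' assume "(0, a') \<in> \<Union>C"
      then show "a' = 0" using derivation_graphD(4)[OF dg(1)] by blast
    qed
    then show "\<Union>C \<in> \<A>" using C(1) dg(2) by (auto simp: \<A>_def)
  qed
  then obtain M where "M \<in> \<A>" and maximal: "\<forall>X\<in>\<A>. M \<subseteq> X \<longrightarrow> X = M"
    by blast
  then have M: "derivation_graph M" "G \<subseteq> M"
    by (auto simp: \<A>_def)
  have max: "X = M" if "derivation_graph X" "M \<subseteq> X" for X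
    using maximal that M(2) by (auto simp: \<A>_def)
  have total: "\<exists>w. (u, w) \<in> M" for u
  proof -
    obtain w where "\<And>p p'. (p, p') \<in> graph_polys M \<Longrightarrow> poly p u = 0 \<Longrightarrow> prolong u w p p' = 0"
      using derivation_graph_extend[OF M(1)] by blast
    from derivation_graph_adjoin[OF M(1) this] show ?thesis using max by blast
  qed
  have unique: "x = y" if "(a, x) \<in> M" "(a, y) \<in> M" for a x y
    using derivation_graphD(2)[OF M(1) that] derivation_graphD(4)[OF M(1)] by fastforce
  define \<delta> where "\<delta> = (\<lambda>a. THE x. (a, x) \<in> M)"
  have in_M: "(a, \<delta> a) \<in> M" for a
    unfolding \<delta>_def by (rule theI') (use total unique in blast)
  have \<delta>: "\<delta> a = x" if "(a, x) \<in> M" for a x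
    using unique in_M that by blast
  have "derivation \<delta>"
    unfolding derivation_def
    using \<delta>[OF derivation_graph_add[OF M(1) in_M in_M]] \<delta>[OF derivation_graphD(3)[OF M(1) in_M in_M]]
    by simp
  then show ?thesis using that \<delta> M(2) by blast
qed

text \<open>Start from the zero derivation on \<open>R\<close>. As \<open>u\<close> satisfies no
  nontrivial relation over \<open>R\<close>, the value 1 can be prescribed there before extending to
  the whole field.\<close>

lemma transcendental_derivation:
  fixes u :: "'a::field_char_0"
  assumes one: "1 \<in> R" and ring: "\<And>a b. a \<in> R \<Longrightarrow> b \<in> R \<Longrightarrow> a - b \<in> R \<and> a * b \<in> R"
    and u: "transcendental_over R u"
  obtains \<delta> where "\<delta> \<in> derivations_killing R" "\<delta> u = 1"
proof -
  have G: "derivation_graph (R \<times> {0})"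
    using one ring by (auto simp: derivation_graph_def)
  have "prolong u 1 p p' = 0" if "(p, p') \<in> graph_polys (R \<times> {0})" "poly p u = 0" for p p'
  proof -
    have "p' = 0"
      using that(1) by (intro poly_eqI) (auto simp: graph_polys_def)
    moreover have "poly_over R p"
      using that(1) by (auto simp: graph_polys_def poly_over_def)
    then have "p = 0"
      using that(2) u unfolding transcendental_over_def by blast
    ultimately show ?thesis by (simp add: prolong_def)
  qed
  note adj = derivation_graph_adjoin[OF G this]
  obtain \<delta> where "derivation \<delta>" and \<delta>: "\<And>a a'. (a, a') \<in> adjoin (R \<times> {0}) u 1 \<Longrightarrow> \<delta> a = a'"
    using derivation_extension[OF adj(1)] by blast
  then have "\<delta> \<in> derivations_killing R" "\<delta> u = 1"
    using adj(2,3) by (auto simp: derivations_killing_def)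
  then show ?thesis by (rule that)
qed

section \<open>A derivation commuting with D\<close>

text \<open>A derivation \<open>\<delta>\<close> with \<open>\<delta> f \<noteq> 0\<close> and as few nonzero values on \<open>H\<close> as possible works after
  scaling one value to 1: otherwise subtracting a multiple of the bracket with \<open>D\<close> would
  remove another nonzero value.\<close>

lemma derivation_constant_values:
  assumes D: "derivation D" and S: "\<And>a. a \<in> S \<Longrightarrow> D a \<in> S"
    and H: "finite H" "\<And>h. h \<in> H \<Longrightarrow> D h \<in> S"
    and f: "f \<in> derivation_closure (S \<union> H)"
    and \<delta>\<^sub>0: "\<delta>\<^sub>0 \<in> derivations_killing S" "\<delta>\<^sub>0 f \<noteq> 0"
  obtains \<delta> where "\<delta> \<in> derivations_killing S" "\<delta> f \<noteq> 0" "\<And>h. h \<in> H \<Longrightarrow> D (\<delta> h) = 0"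
proof -
  define supp where "supp = (\<lambda>\<delta> :: 'a \<Rightarrow> 'a. {h \<in> H. \<delta> h \<noteq> 0})"
  define Q where "Q = (\<lambda>\<delta>. \<delta> \<in> derivations_killing S \<and> \<delta> f \<noteq> 0)"
  define \<delta> where "\<delta> = arg_min (\<lambda>\<delta>. card (supp \<delta>)) Q"
  have "Q \<delta>"
    unfolding \<delta>_def by (rule arg_min_natI[of Q \<delta>\<^sub>0]) (use \<delta>\<^sub>0 in \<open>simp add: Q_def\<close>)
  then have \<delta>: "\<delta> \<in> derivations_killing S" "\<delta> f \<noteq> 0" by (simp_all add: Q_def)
  have min: "\<epsilon> f = 0" if "\<epsilon> \<in> derivations_killing S" "supp \<epsilon> \<subset> supp \<delta>" for \<epsilon>
  proof (rule ccontr)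
    assume "\<epsilon> f \<noteq> 0"
    then have "Q \<epsilon>"
      using that(1) by (simp add: Q_def)
    then have "card (supp \<delta>) \<le> card (supp \<epsilon>)"
      unfolding \<delta>_def by (rule arg_min_nat_le[of Q \<epsilon> "\<lambda>\<delta>. card (supp \<delta>)"])
    moreover have "card (supp \<epsilon>) < card (supp \<delta>)"
      using that(2) H(1) by (intro psubset_card_mono) (auto simp: supp_def)
    ultimately show False by simp
  qed
  have "\<exists>h\<^sub>0\<in>H. \<delta> h\<^sub>0 \<noteq> 0"
    using f \<delta> by (auto simp: derivation_closure_def derivations_killing_def)
  then obtain h\<^sub>0 where h\<^sub>0: "h\<^sub>0 \<in> H" "\<delta> h\<^sub>0 \<noteq> 0" by blast
  \<comment> \<open>With the value at \<open>h\<^sub>0\<close> scaled to the constant 1, the bracket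
    with \<open>D\<close> vanishes at \<open>h\<^sub>0\<close>. Its support is then strictly
    smaller, and minimality forces it to kill \<open>f\<close>.\<close>
  define \<gamma> where "\<gamma> = (\<lambda>u. inverse (\<delta> h\<^sub>0) * \<delta> u)"
  have \<gamma>: "\<gamma> \<in> derivations_killing S" "\<gamma> f \<noteq> 0" "\<gamma> h\<^sub>0 = 1" "supp \<gamma> = supp \<delta>"
    using \<delta> h\<^sub>0 derivations_killing_scale[of \<delta> S] by (auto simp: \<gamma>_def supp_def)
  define \<epsilon> where "\<epsilon> = (\<lambda>u. D (\<gamma> u) - \<gamma> (D u))"
  have \<gamma>_kills: "\<gamma> a = 0" if "a \<in> S" for a
    using \<gamma>(1) that by (auto simp: derivations_killing_def)
  have \<epsilon>: "\<epsilon> \<in> derivations_killing S"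
    unfolding \<epsilon>_def using S \<gamma>_kills by (intro derivations_killing_bracket D \<gamma>) auto
  have \<epsilon>_H: "\<epsilon> h = D (\<gamma> h)" if "h \<in> H" for h
    using H(2)[OF that] \<gamma>_kills by (simp add: \<epsilon>_def)
  have "supp \<epsilon> \<subseteq> supp \<gamma>"
    using \<epsilon>_H by (auto simp: supp_def derivation_0[OF D])
  moreover have "h\<^sub>0 \<in> supp \<gamma>" "h\<^sub>0 \<notin> supp \<epsilon>"
    using h\<^sub>0 \<gamma>(3) \<epsilon>_H[OF h\<^sub>0(1)] by (auto simp: supp_def derivation_1[OF D])
  ultimately have "\<epsilon> f = 0"
    using min[OF \<epsilon>] \<gamma>(4) by blast
  have "\<epsilon> h = 0" if h: "h \<in> H" for h
  proof (rule ccontr)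
    assume "\<epsilon> h \<noteq> 0"
    \<comment> \<open>\<open>\<zeta>\<close> vanishes at \<open>h\<close> yet agrees with
      \<open>\<gamma>\<close> at \<open>f\<close>, because \<open>\<epsilon> f = 0\<close>; this
      contradicts minimality.\<close>
    define \<zeta> where "\<zeta> = (\<lambda>u. \<gamma> u - (\<gamma> h / \<epsilon> h) * \<epsilon> u)"
    have "\<zeta> \<in> derivations_killing S"
      unfolding \<zeta>_def by (intro derivations_killing_diff derivations_killing_scale \<gamma> \<epsilon>)
    moreover have "supp \<zeta> \<subseteq> supp \<gamma>"
      using \<open>supp \<epsilon> \<subseteq> supp \<gamma>\<close> by (auto simp: supp_def \<zeta>_def)
    moreover have "h \<in> supp \<gamma>" "h \<notin> supp \<zeta>"
      using \<open>\<epsilon> h \<noteq> 0\<close> \<open>supp \<epsilon> \<subseteq> supp \<gamma>\<close> h by (auto simp: supp_def \<zeta>_def)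
    ultimately have "\<zeta> f = 0"
      using min \<gamma>(4) by blast
    with \<open>\<epsilon> f = 0\<close> \<gamma>(2) show False by (simp add: \<zeta>_def)
  qed
  then show ?thesis
    using that[OF \<gamma>(1,2)] \<epsilon>_H by simp
qed

section \<open>Subfields and truncated Taylor sums\<close>

lemma subfieldD:
  assumes "subfield k"
  shows "0 \<in> k" "1 \<in> k" "a \<in> k \<Longrightarrow> b \<in> k \<Longrightarrow> a + b \<in> k" "a \<in> k \<Longrightarrow> b \<in> k \<Longrightarrow> a * b \<in> k"
    "a \<in> k \<Longrightarrow> - a \<in> k" "a \<in> k \<Longrightarrow> inverse a \<in> k"
  using assms by (auto simp: subfield_def)

lemma subfield_diff: "subfield k \<Longrightarrow> a \<in> k \<Longrightarrow> b \<in> k \<Longrightarrow> a - b \<in> k"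
  using subfieldD(3)[of k a "- b"] by (simp add: subfieldD(5))

lemma subfield_divide: "subfield k \<Longrightarrow> a \<in> k \<Longrightarrow> b \<in> k \<Longrightarrow> a / b \<in> k"
  by (simp add: divide_inverse subfieldD)

lemma subfield_power: "subfield k \<Longrightarrow> a \<in> k \<Longrightarrow> a ^ n \<in> k"
  by (induction n) (simp_all add: subfieldD)

lemma subfield_of_nat: "subfield k \<Longrightarrow> of_nat n \<in> k"
  by (induction n) (simp_all add: subfieldD)

lemma subfield_sum: "subfield k \<Longrightarrow> (\<And>i. i \<in> A \<Longrightarrow> F i \<in> k) \<Longrightarrow> (\<Sum>i\<in>A. F i) \<in> k"
  by (induction A rule: infinite_finite_induct) (simp_all add: subfieldD)

definition taylor_coeff :: "'a::field_char_0 \<Rightarrow> nat \<Rightarrow> 'a" where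
  "taylor_coeff x j = (- x) ^ j / fact j"

text \<open>The first \<open>m\<close> terms of \<open>exp (- x D) u\<close>, powers of
  \<open>x\<close> standing to the left of those of \<open>D\<close>: formally, the Taylor expansion
  giving the value of \<open>u\<close> where \<open>x\<close> vanishes.\<close>

definition taylor :: "('a::field_char_0 \<Rightarrow> 'a) \<Rightarrow> 'a \<Rightarrow> nat \<Rightarrow> 'a \<Rightarrow> 'a" where
  "taylor D x m u = (\<Sum>j<m. taylor_coeff x j * (D ^^ j) u)"

lemma taylor_coeff_in_subfield: "subfield k \<Longrightarrow> x \<in> k \<Longrightarrow> taylor_coeff x j \<in> k"
  using subfield_of_nat[of k "fact j"]
  by (simp add: taylor_coeff_def subfield_divide subfield_power subfieldD)

lemma taylor_coeff_Suc: "of_nat (Suc j) * taylor_coeff x (Suc j) = - x * taylor_coeff x j"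
  by (simp add: taylor_coeff_def field_simps del: of_nat_Suc)

lemma derivation_taylor_coeff_Suc:
  assumes D: "derivation D" and x: "D x = 1"
  shows "D (taylor_coeff x (Suc j)) = - taylor_coeff x j"
proof (induction j)
  case 0
  show ?case
    using x by (simp add: taylor_coeff_def derivation_minus[OF D])
next
  case (Suc j)
  have "D (of_nat (Suc (Suc j)) * taylor_coeff x (Suc (Suc j))) = D (- x * taylor_coeff x (Suc j))"
    by (simp only: taylor_coeff_Suc)
  then have "of_nat (Suc (Suc j)) * D (taylor_coeff x (Suc (Suc j)))
      = - taylor_coeff x (Suc j) + x * taylor_coeff x j"
    by (simp only: derivation_mult[OF D] derivation_of_nat[OF D] derivation_minus[OF D] x Suc) simp
  also have "\<dots> = of_nat (Suc (Suc j)) * (- taylor_coeff x (Suc j))"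
  proof -
    have eq: "x * taylor_coeff x j = - (of_nat (Suc j) * taylor_coeff x (Suc j))"
      by (simp only: taylor_coeff_Suc) simp
    show ?thesis unfolding eq by (simp add: algebra_simps)
  qed
  finally show ?case
    by (simp only: mult_cancel_left of_nat_eq_0_iff) simp
qed

text \<open>The sum telescopes: differentiating each coefficient cancels what differentiating the
  preceding iterate produces, and only the last term survives.\<close>

lemma derivation_taylor:
  assumes D: "derivation D" and x: "D x = 1"
  shows "D (taylor D x (Suc m) u) = taylor_coeff x m * (D ^^ Suc m) u"
proof (induction m)
  case 0
  show ?case by (simp add: taylor_def taylor_coeff_def)
next
  case (Suc m)
  have "D (taylor D x (Suc (Suc m)) u)
      = D (taylor D x (Suc m) u) + D (taylor_coeff x (Suc m) * (D ^^ Suc m) u)"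
    by (simp add: taylor_def derivation_add[OF D])
  then show ?case
    by (simp add: Suc derivation_mult[OF D] derivation_taylor_coeff_Suc[OF D x])
qed

text \<open>Each Taylor sum is \<open>(D ^^ i) f\<close> plus a \<open>k\<close>-combination of
  higher derivatives. As \<open>\<delta>\<close> is \<open>k\<close>-linear, this unitriangular
  system is solved downwards from \<open>i = n - 1\<close>. \<open>I\<close> is general so as to
  cover both \<open>{0}\<close> and \<open>k\<close>.\<close>

lemma derivation_iterate_from_taylor:
  assumes k: "subfield k" "x \<in> k" and \<delta>: "\<delta> \<in> derivations_killing k"
    and I: "0 \<in> I" "\<And>a b. a \<in> I \<Longrightarrow> b \<in> I \<Longrightarrow> a + b \<in> I" "\<And>c a. c \<in> k \<Longrightarrow> a \<in> I \<Longrightarrow> c * a \<in> I"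
    and h: "\<And>i. i < n \<Longrightarrow> \<delta> (taylor D x (n - i) ((D ^^ i) f)) \<in> I"
    and "i < n"
  shows "\<delta> ((D ^^ i) f) \<in> I"
  using \<open>i < n\<close>
proof (induction "n - i" arbitrary: i rule: less_induct)
  case less
  have d: "derivation \<delta>" using \<delta> by (simp add: derivations_killing_def)
  have lin: "\<delta> (c * u) = c * \<delta> u" if "c \<in> k" for c u
    using \<delta> that by (simp add: derivations_killing_def derivation_mult)
  obtain m where m: "n - i = Suc m" using less.prems by (metis Suc_diff_Suc)
  define s where "s = (\<Sum>j<m. taylor_coeff x (Suc j) * (D ^^ (Suc j + i)) f)"
  have "taylor D x (n - i) ((D ^^ i) f) = (D ^^ i) f + s"
    unfolding taylor_def m s_def sum.lessThan_Suc_shift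
    by (simp add: funpow_add[THEN fun_cong, unfolded o_apply, symmetric] taylor_coeff_def[of x 0]
        del: funpow.simps(2))
  then have eq: "\<delta> ((D ^^ i) f) = \<delta> (taylor D x (n - i) ((D ^^ i) f)) + (- 1) * \<delta> s"
    by (simp add: derivation_add[OF d])
  have "\<delta> s = (\<Sum>j<m. taylor_coeff x (Suc j) * \<delta> ((D ^^ (Suc j + i)) f))"
    unfolding s_def derivation_sum[OF d] using taylor_coeff_in_subfield[OF k] by (simp only: lin)
  moreover have "(\<Sum>j<l. taylor_coeff x (Suc j) * \<delta> ((D ^^ (Suc j + i)) f)) \<in> I" if "l \<le> m" for l
    using that
  proof (induction l)
    case 0
    show ?case by (simp add: I(1))
  next
    case (Suc l)
    have "\<delta> ((D ^^ (Suc l + i)) f) \<in> I"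
      using Suc.prems m less.prems by (intro less.hyps) auto
    then show ?case
      unfolding sum.lessThan_Suc
      using Suc.IH Suc.prems I(2) I(3)[OF taylor_coeff_in_subfield[OF k]] by simp
  qed
  ultimately have "\<delta> s \<in> I" by simp
  then show ?case
    unfolding eq
    using I(2)[OF h[OF less.prems] I(3)[OF subfieldD(5)[OF k(1) subfieldD(2)[OF k(1)]]]] by blast
qed

text \<open>The Taylor sums of the iterated derivatives of \<open>f\<close> have derivatives in
  \<open>k\<close> and determine \<open>f\<close>, so \<open>derivation_constant_values\<close>
  applies to them. \<open>Z\<close> records where commutation with \<open>D\<close> is obtained,
  which is not the whole field.\<close>

lemma commuting_derivation:
  fixes D :: "'a::field_char_0 \<Rightarrow> 'a"
  assumes D: "derivation D" and k: "differential_subfield D k" and C: "constants D \<subseteq> k"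
    and f: "iterated_integral D k f" "transcendental_over k f" and x: "x \<in> k" "D x = 1"
  obtains \<delta> Z where "\<delta> \<in> derivations_killing k" "\<delta> f \<in> k" "\<delta> f \<noteq> 0"
    "derivation_closure (k \<union> {f}) \<subseteq> Z"
    "\<And>u. u \<in> Z \<Longrightarrow> D u \<in> Z" "\<And>u. u \<in> Z \<Longrightarrow> \<delta> u \<in> Z" "\<And>u. u \<in> Z \<Longrightarrow> D (\<delta> u) = \<delta> (D u)"
proof -
  have sf: "subfield k" and Dk: "\<And>a. a \<in> k \<Longrightarrow> D a \<in> k"
    using k by (auto simp: differential_subfield_def)
  obtain n where n: "(D ^^ n) f \<in> k" using f(1) by (auto simp: iterated_integral_def)
  have "f \<notin> k"
  proof
    assume "f \<in> k"
    then have "poly_over k [:- f, 1:]" "poly [:- f, 1:] f = 0"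
      using sf by (auto simp: poly_over_def coeff_pCons subfieldD split: nat.split)
    then have "[:- f, 1:] = 0"
      using f(2) unfolding transcendental_over_def by blast
    then show False by simp
  qed
  then have "0 < n" using n by (intro gr0I) auto
  define H where "H = (\<lambda>i. taylor D x (n - i) ((D ^^ i) f)) ` {..<n}"
  have DH: "D h \<in> k" if h: "h \<in> H" for h
  proof -
    obtain i where i: "i < n" "h = taylor D x (n - i) ((D ^^ i) f)"
      using h by (auto simp: H_def)
    then obtain m where m: "n - i = Suc m" by (metis Suc_diff_Suc)
    then have eq: "n = Suc m + i" using i by simp
    have "(D ^^ Suc m) ((D ^^ i) f) = (D ^^ n) f"
      unfolding eq funpow_add o_apply ..
    then show ?thesis
      unfolding i(2) m derivation_taylor[OF D x(2)]
      using subfieldD(4)[OF sf taylor_coeff_in_subfield[OF sf x(1)] n] by simp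
  qed
  have kills_f: "\<epsilon> f = 0" if "\<epsilon> \<in> derivations_killing (k \<union> H)" for \<epsilon>
  proof -
    have "\<epsilon> ((D ^^ 0) f) \<in> {0}"
      by (rule derivation_iterate_from_taylor[OF sf x(1), of \<epsilon> _ n])
        (use that \<open>0 < n\<close> in \<open>auto simp: derivations_killing_def H_def\<close>)
    then show ?thesis by simp
  qed
  obtain \<delta>\<^sub>0 where \<delta>\<^sub>0: "\<delta>\<^sub>0 \<in> derivations_killing k" "\<delta>\<^sub>0 f = 1"
    using transcendental_derivation[OF subfieldD(2)[OF sf] _ f(2)] sf
    by (metis subfieldD(4) subfield_diff)
  obtain \<delta> where \<delta>: "\<delta> \<in> derivations_killing k" "\<delta> f \<noteq> 0"
    and \<delta>H: "\<And>h. h \<in> H \<Longrightarrow> D (\<delta> h) = 0"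
  proof (rule derivation_constant_values[OF D Dk, of H f \<delta>\<^sub>0])
    show "finite H" by (simp add: H_def)
    show "f \<in> derivation_closure (k \<union> H)" using kills_f by (simp add: derivation_closure_def)
  qed (use DH \<delta>\<^sub>0 in auto)
  have \<delta>H_k: "\<delta> h \<in> k" if "h \<in> H" for h
    using \<delta>H[OF that] C by (auto simp: constants_def)
  have d: "derivation \<delta>" and \<delta>k: "\<And>a. a \<in> k \<Longrightarrow> \<delta> a = 0"
    using \<delta> by (auto simp: derivations_killing_def)
  \<comment> \<open>Closing up \<open>k \<union> H\<close> makes \<open>D\<close>-stability
    immediate, since \<open>D\<close> maps \<open>H\<close> into \<open>k\<close>; nothing
    comparable is known about \<open>D f\<close> over \<open>k\<close> and \<open>f\<close>
    alone.\<close>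
  define Z where "Z = derivation_closure (k \<union> H)"
  have kZ: "k \<subseteq> Z" using derivation_closure_superset[of "k \<union> H"] by (auto simp: Z_def)
  show ?thesis
  proof (rule that[of \<delta> Z])
    have "\<delta> ((D ^^ 0) f) \<in> k"
      by (rule derivation_iterate_from_taylor[OF sf x(1) \<delta>(1), of _ n])
        (use \<delta>H_k \<open>0 < n\<close> sf in \<open>auto simp: H_def subfieldD\<close>)
    then show "\<delta> f \<in> k" by simp
    show "derivation_closure (k \<union> {f}) \<subseteq> Z"
    proof -
      have "derivations_killing (k \<union> H) \<subseteq> derivations_killing (k \<union> {f})"
        using kills_f by (auto simp: derivations_killing_def)
      then show ?thesis by (auto simp: Z_def derivation_closure_def)
    qed
    show "D u \<in> Z" if "u \<in> Z" for u
      using that kZ Dk DH unfolding Z_def by - (rule derivation_closure_stable[OF D], auto)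
    have "0 \<in> k" using sf by (rule subfieldD)
    then show "\<delta> u \<in> Z" if "u \<in> Z" for u
      using that kZ \<delta>k \<delta>H_k unfolding Z_def by - (rule derivation_closure_stable[OF d], auto)
    \<comment> \<open>On \<open>H\<close> both halves of the bracket vanish:
      \<open>\<delta> h\<close> is a constant, and \<open>D h\<close> lies in
      \<open>k\<close>.\<close>
    have "(\<lambda>u. D (\<delta> u) - \<delta> (D u)) \<in> derivations_killing (k \<union> H)"
      using derivation_bracket[OF D d] \<delta>k \<delta>H Dk DH derivation_0[OF D]
      by (auto simp: derivations_killing_def)
    then show "D (\<delta> u) = \<delta> (D u)" if "u \<in> Z" for u
      using that by (auto simp: Z_def derivation_closure_def)
  qed (use \<delta> in auto)
qed

section \<open>Linear dependence over the constants\<close>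

text \<open>Gaussian elimination on the last coordinate. One vector is expressed by its
  predecessors, the form in which a least \<open>m\<close> can later be chosen.\<close>

lemma vectors_dependent:
  fixes v :: "nat \<Rightarrow> nat \<Rightarrow> 'a::field"
  shows "\<exists>m c. \<forall>j<N. v m j = (\<Sum>i<m. c i * v i j)"
proof (induction N arbitrary: v)
  case 0
  then show ?case by simp
next
  case (Suc N)
  show ?case
  proof (cases "\<forall>i. v i N = 0")
    case True
    obtain m c where "\<forall>j<N. v m j = (\<Sum>i<m. c i * v i j)"
      using Suc[of v] by blast
    then have "\<forall>j<Suc N. v m j = (\<Sum>i<m. c i * v i j)"
      using True by (simp add: less_Suc_eq)
    then show ?thesis by blast
  next
    case False
    then obtain p where p: "v p N \<noteq> 0" by blast
    \<comment> \<open>Vectors before the pivot \<open>p\<close> are ignored; the later ones are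
      cleared in coordinate \<open>N\<close>.\<close>
    define r where "r = (\<lambda>i. v (p + 1 + i) N / v p N)"
    define w where "w = (\<lambda>i j. v (p + 1 + i) j - r i * v p j)"
    obtain m c where mc: "\<forall>j<N. w m j = (\<Sum>i<m. c i * w i j)"
      using Suc[of w] by blast
    have "w i N = 0" for i using p by (simp add: w_def r_def)
    then have mc: "\<forall>j<Suc N. w m j = (\<Sum>i<m. c i * w i j)"
      using mc by (simp add: less_Suc_eq)
    define e where "e = r m - (\<Sum>i<m. c i * r i)"
    define c' where "c' = (\<lambda>i. if i < p then 0 else if i = p then e else c (i - (p + 1)))"
    have sum: "(\<Sum>i<p + 1 + l. c' i * F i) = e * F p + (\<Sum>i<l. c i * F (p + 1 + i))"
      for l and F :: "nat \<Rightarrow> 'a"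
      by (induction l) (simp_all add: c'_def)
    have "v (p + 1 + m) j = (\<Sum>i<p + 1 + m. c' i * v i j)" if "j < Suc N" for j
    proof -
      have "v (p + 1 + m) j = w m j + r m * v p j" by (simp add: w_def)
      also have "w m j = (\<Sum>i<m. c i * v (p + 1 + i) j) - (\<Sum>i<m. c i * r i) * v p j"
        using mc that
        by (simp add: w_def algebra_simps sum_subtractf sum_distrib_left sum_distrib_right)
      finally show ?thesis unfolding sum by (simp add: e_def algebra_simps)
    qed
    then show ?thesis by blast
  qed
qed

text \<open>Differentiating a linear relation of minimal length among the jets gives a shorter one, so its
  coefficients are constants.\<close>

lemma ode_solutions_dependent:
  fixes D :: "'a::field \<Rightarrow> 'a"
    and y :: "nat \<Rightarrow> 'a"
  assumes D: "derivation D" and a: "a N \<noteq> 0"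
    and ode: "\<And>i. (\<Sum>j\<le>N. a j * (D ^^ j) (y i)) = 0"
  obtains m c where "\<And>i. i < m \<Longrightarrow> D (c i) = 0" "y m = (\<Sum>i<m. c i * y i)"
proof -
  define R where "R = (\<lambda>m c. \<forall>j<N. (D ^^ j) (y m) = (\<Sum>i<m. c i * (D ^^ j) (y i)))"
  define m where "m = (LEAST m. \<exists>c. R m c)"
  have "\<exists>m c. R m c"
    using vectors_dependent[where v = "\<lambda>i j. (D ^^ j) (y i)"] by (simp add: R_def)
  then have "\<exists>c. R m c" unfolding m_def by (rule LeastI_ex)
  then obtain c where c: "R m c" by blast
  have top: "(D ^^ N) (y i) = (\<Sum>j<N. (- a j / a N) * (D ^^ j) (y i))" for i
  proof -
    have "a N * (D ^^ N) (y i) = - (\<Sum>j<N. a j * (D ^^ j) (y i))"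
      using ode[of i] by (simp add: lessThan_Suc_atMost[symmetric] add_eq_0_iff)
    then have "(D ^^ N) (y i) = - (\<Sum>j<N. a j * (D ^^ j) (y i)) / a N"
      using a by (simp add: field_simps)
    then show ?thesis
      by (simp add: sum_negf[symmetric] sum_divide_distrib)
  qed
  \<comment> \<open>The equation carries the relation to order \<open>N\<close>, one more than
    \<open>R\<close> demands. This leaves room to differentiate once, and it gives order 0 even when
    \<open>N = 0\<close>.\<close>
  have rel: "(D ^^ j) (y m) = (\<Sum>i<m. c i * (D ^^ j) (y i))" if "j \<le> N" for j
  proof (cases "j = N")
    case True
    have "(D ^^ N) (y m) = (\<Sum>j<N. (- a j / a N) * (\<Sum>i<m. c i * (D ^^ j) (y i)))"
      unfolding top using c by (intro sum.cong) (auto simp: R_def)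
    also have "\<dots> = (\<Sum>i<m. c i * (D ^^ N) (y i))"
      unfolding top sum_distrib_left by (subst sum.swap) (simp add: mult.left_commute)
    finally show ?thesis using True by simp
  next
    case False
    then show ?thesis using c that by (simp add: R_def)
  qed
  have deriv: "(\<Sum>i<m. D (c i) * (D ^^ j) (y i)) = 0" if "j < N" for j
  proof -
    have "(D ^^ Suc j) (y m) = D (\<Sum>i<m. c i * (D ^^ j) (y i))"
      using rel[of j] that by simp
    also have "\<dots> = (\<Sum>i<m. D (c i) * (D ^^ j) (y i)) + (\<Sum>i<m. c i * (D ^^ Suc j) (y i))"
      by (simp add: derivation_sum[OF D] derivation_mult[OF D] sum.distrib)
    finally show ?thesis using rel[of "Suc j"] that by simp
  qed
  have "D (c i) = 0" if i: "i < m" for i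
  proof (rule ccontr)
    assume "D (c i) \<noteq> 0"
    \<comment> \<open>For the last index \<open>l\<close> with a nonconstant coefficient, the
      differentiated relation expresses the jet of \<open>y l\<close> by earlier ones, against the
      choice of \<open>m\<close>.\<close>
    define B where "B = {i. i < m \<and> D (c i) \<noteq> 0}"
    define l where "l = Max B"
    have B: "finite B" "B \<noteq> {}" using i \<open>D (c i) \<noteq> 0\<close> by (auto simp: B_def)
    then have l: "l < m" "D (c l) \<noteq> 0"
      using Max_in[of B] unfolding l_def by (auto simp: B_def)
    have above: "D (c i) = 0" if "l < i" "i < m" for i
    proof -
      have "i \<notin> B" using Max_ge[OF B(1), of i] that(1) by (auto simp: l_def)
      then show ?thesis using that(2) by (simp add: B_def)
    qed
    have "R l (\<lambda>i. - D (c i) / D (c l))"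
      unfolding R_def
    proof (intro allI impI)
      fix j assume "j < N"
      have "(\<Sum>i<m. D (c i) * (D ^^ j) (y i)) = (\<Sum>i<Suc l. D (c i) * (D ^^ j) (y i))"
        using l(1) above by (intro sum.mono_neutral_right) auto
      then have "D (c l) * (D ^^ j) (y l) = - (\<Sum>i<l. D (c i) * (D ^^ j) (y i))"
        using deriv[OF \<open>j < N\<close>] by (simp add: add_eq_0_iff)
      then have "(D ^^ j) (y l) = - (\<Sum>i<l. D (c i) * (D ^^ j) (y i)) / D (c l)"
        using l(2) by (simp add: field_simps)
      then show "(D ^^ j) (y l) = (\<Sum>i<l. - D (c i) / D (c l) * (D ^^ j) (y i))"
        by (simp add: sum_negf[symmetric] sum_divide_distrib)
    qed
    then have "m \<le> l" unfolding m_def by (intro Least_le) blast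
    with l(1) show False by simp
  qed
  moreover have "y m = (\<Sum>i<m. c i * y i)" using rel[of 0] by simp
  ultimately show ?thesis by (rule that)
qed

section \<open>Elements algebraic over k(f)\<close>

lemma derivations_killing_poly:
  assumes "\<delta> \<in> derivations_killing k" "poly_over k p"
  shows "\<delta> (poly p f) = poly (pderiv p) f * \<delta> f"
proof -
  have "map_poly \<delta> p = 0"
    using assms
    by (intro poly_eqI) (auto simp: coeff_map_poly derivations_killing_def poly_over_def derivation_0)
  then show ?thesis
    using assms(1) by (simp add: derivation_poly derivations_killing_def)
qed

lemma poly_over_pderiv: "subfield k \<Longrightarrow> poly_over k p \<Longrightarrow> poly_over k (pderiv p)"
  by (simp add: poly_over_def coeff_pderiv subfieldD subfield_of_nat del: of_nat_Suc)

lemma poly_over_mult: "subfield k \<Longrightarrow> poly_over k p \<Longrightarrow> poly_over k q \<Longrightarrow> poly_over k (p * q)"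
  by (simp add: poly_over_def coeff_mult subfieldD subfield_sum)

lemma poly_over_smult: "subfield k \<Longrightarrow> c \<in> k \<Longrightarrow> poly_over k p \<Longrightarrow> poly_over k (smult c p)"
  by (simp add: poly_over_def subfieldD)

lemma poly_over_add: "subfield k \<Longrightarrow> poly_over k p \<Longrightarrow> poly_over k q \<Longrightarrow> poly_over k (p + q)"
  by (simp add: poly_over_def subfieldD)

lemma poly_over_diff: "subfield k \<Longrightarrow> poly_over k p \<Longrightarrow> poly_over k q \<Longrightarrow> poly_over k (p - q)"
  by (simp add: poly_over_def subfield_diff)

lemma poly_over_monom: "subfield k \<Longrightarrow> c \<in> k \<Longrightarrow> poly_over k (monom c n)"
  by (simp add: poly_over_def subfieldD)

lemma poly_over_sum:
  "subfield k \<Longrightarrow> (\<And>i. i \<in> A \<Longrightarrow> poly_over k (F i)) \<Longrightarrow> poly_over k (\<Sum>i\<in>A. F i)"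
  by (simp add: poly_over_def coeff_sum subfield_sum)

lemma poly_in_derivation_closure:
  assumes "poly_over k p"
  shows "poly p f \<in> derivation_closure (k \<union> {f})"
proof -
  have "\<delta> (poly p f) = 0" if "\<delta> \<in> derivations_killing (k \<union> {f})" for \<delta>
    using derivations_killing_poly[OF _ assms, of \<delta> f] that by (simp add: derivations_killing_def)
  then show ?thesis by (simp add: derivation_closure_def)
qed

text \<open>A derivation \<open>\<delta>\<close> that kills \<open>k\<close> and \<open>f\<close> but not \<open>g\<close> allows one to differentiate a
  relation in \<open>g\<close> down to a relation over \<open>k\<close> for \<open>f\<close> alone.\<close>

lemma algebraically_dependent_in_closure:
  fixes f g :: "'a::field_char_0"
  assumes k: "subfield k" and f: "transcendental_over k f"
    and g: "algebraically_dependent_over k f g"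
  shows "g \<in> derivation_closure (k \<union> {f})"
proof (rule ccontr)
  assume "g \<notin> derivation_closure (k \<union> {f})"
  then obtain \<delta> where \<delta>: "\<delta> \<in> derivations_killing k" "\<delta> f = 0" "\<delta> g \<noteq> 0"
    by (auto simp: derivation_closure_def derivations_killing_def)
  have d: "derivation \<delta>" using \<delta>(1) by (simp add: derivations_killing_def)
  \<comment> \<open>Induction on a bound \<open>N\<close> for the degrees in the variable replaced
    by \<open>g\<close>; at \<open>N = 0\<close> the relation involves \<open>f\<close>
    alone.\<close>
  have "P = 0" if "\<forall>i. poly_over k (coeff P i)" "\<forall>i. degree (coeff P i) \<le> N" "eval2 P f g = 0"
    for N P
    using that
  proof (induction N arbitrary: P)
    case 0
    define p where "p = map_poly (\<lambda>q. poly q g) P"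
    have p: "coeff P i = [:coeff p i:]" for i
    proof -
      obtain c where "coeff P i = [:c:]" using 0(2) by (metis degree_eq_zeroE le_zero_eq)
      then show ?thesis by (simp add: p_def coeff_map_poly)
    qed
    have "coeff p i \<in> k" for i
    proof -
      have "coeff (coeff P i) 0 \<in> k" using 0(1) by (simp add: poly_over_def)
      then show ?thesis by (simp only: p coeff_pCons_0)
    qed
    then have "poly_over k p" by (simp add: poly_over_def)
    moreover have "poly p f = 0"
      using 0(3) by (simp add: eval2_def p_def)
    ultimately have "p = 0"
      using f by (simp add: transcendental_over_def)
    with p show ?case by (simp add: poly_eq_iff[of P])
  next
    case (Suc N)
    have "map_poly \<delta> (map_poly (\<lambda>q. poly q g) P)
        = smult (\<delta> g) (map_poly (\<lambda>q. poly q g) (map_poly pderiv P))"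
      using Suc.prems(1) derivations_killing_poly[OF \<delta>(1)]
      by (intro poly_eqI) (simp add: coeff_map_poly derivation_0[OF d])
    \<comment> \<open>Since \<open>\<delta>\<close> kills \<open>k\<close> and \<open>f\<close>,
      only the variable replaced by \<open>g\<close> gets differentiated.\<close>
    then have "\<delta> (eval2 P f g) = \<delta> g * eval2 (map_poly pderiv P) f g"
      using \<delta> by (simp add: eval2_def derivation_poly derivations_killing_def)
    then have "eval2 (map_poly pderiv P) f g = 0"
      using Suc.prems(3) \<delta> by (simp add: derivations_killing_def derivation_0)
    then have "map_poly pderiv P = 0"
      using Suc.prems(1,2) poly_over_pderiv[OF k]
      by (intro Suc.IH) (simp_all add: coeff_map_poly degree_pderiv le_diff_conv)
    then have "pderiv (coeff P i) = 0" for i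
      by (metis coeff_0 coeff_map_poly pderiv_0)
    then have "degree (coeff P i) = 0" for i
      by (simp add: pderiv_eq_0_iff)
    then show ?case using Suc by simp
  qed
  moreover obtain P where P: "P \<noteq> 0" "\<forall>i. poly_over k (coeff P i)" "eval2 P f g = 0"
    using g by (auto simp: algebraically_dependent_over_def)
  moreover have "degree (coeff P i) \<le> (\<Sum>i\<le>degree P. degree (coeff P i))" for i
  proof (cases "i \<le> degree P")
    case True
    then show ?thesis by (intro member_le_sum) auto
  next
    case False
    then show ?thesis by (simp add: coeff_eq_0)
  qed
  ultimately show False by blast
qed

section \<open>Splitting polynomials over an algebraically closed subfield\<close>

lemma poly_over_linear_factor:
  assumes k: "subfield k" and r: "r \<in> k" and p: "poly_over k ([:- r, 1:] * q)"
  shows "poly_over k q"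
proof -
  \<comment> \<open>Synthetic division: the coefficients of \<open>q\<close> are recovered from the
    top down.\<close>
  have step: "coeff q i = coeff ([:- r, 1:] * q) (Suc i) + r * coeff q (Suc i)" for i
    by simp
  have "coeff q i \<in> k" if "degree q < i + n" for i n
    using that
  proof (induction n arbitrary: i)
    case 0
    then show ?case by (simp add: coeff_eq_0 subfieldD[OF k])
  next
    case (Suc n)
    then have "coeff q (Suc i) \<in> k" by simp
    then show ?case
      using p r by (subst step) (simp only: poly_over_def subfieldD[OF k])
  qed
  from this[of _ "Suc (degree q)"] show ?thesis
    by (simp add: poly_over_def)
qed

lemma algebraically_closed_factor:
  assumes "algebraically_closed_subfield k" "poly_over k p" "degree p = Suc n"
  obtains r q where "r \<in> k" "p = [:- r, 1:] * q" "poly_over k q" "degree q = n"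
proof -
  have k: "subfield k" using assms(1) by (simp add: algebraically_closed_subfield_def)
  obtain r where r: "r \<in> k" "poly p r = 0"
    using assms by (auto simp: algebraically_closed_subfield_def)
  then obtain q where q: "p = [:- r, 1:] * q" by (auto simp: poly_eq_0_iff_dvd)
  then have "q \<noteq> 0" using assms(3) by auto
  then have "degree p = Suc (degree q)"
    unfolding q by (subst degree_mult_eq) auto
  then show ?thesis
    using that[OF r(1) q poly_over_linear_factor[OF k r(1)]] assms(2,3) unfolding q[symmetric] by simp
qed

text \<open>\<open>p\<close> splits into linear factors over \<open>k\<close>, which leaves no room
  for roots outside \<open>k\<close>.\<close>

lemma algebraically_closed_root:
  assumes k: "algebraically_closed_subfield k"
  shows "poly_over k p \<Longrightarrow> p \<noteq> 0 \<Longrightarrow> poly p u = 0 \<Longrightarrow> u \<in> k"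
proof (induction "degree p" arbitrary: p)
  case 0
  then show ?case by (auto elim!: degree_eq_zeroE)
next
  case (Suc n)
  obtain r q where rq: "r \<in> k" "p = [:- r, 1:] * q" "poly_over k q" "degree q = n"
    using algebraically_closed_factor[OF k Suc.prems(1)] Suc.hyps(2) by metis
  have "(u - r) * poly q u = poly p u" by (simp add: rq(2) algebra_simps)
  then have "u = r \<or> poly q u = 0" using Suc.prems(3) by simp
  moreover have "q \<noteq> 0" using Suc.prems(2) rq(2) by (metis mult_zero_right)
  ultimately show ?case using Suc.hyps(1)[OF rq(4)[symmetric] rq(3)] rq(1) by blast
qed

section \<open>Constants and eigenvectors of \<delta> in the closure of k and f\<close>

lemma closure_constant:
  fixes f :: "'a::field_char_0"
  assumes k: "algebraically_closed_subfield k"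
    and \<delta>: "\<delta> \<in> derivations_killing k" "\<delta> f \<noteq> 0"
    and u: "u \<in> derivation_closure (k \<union> {f})" "\<delta> u = 0"
  shows "u \<in> k"
proof (rule ccontr)
  assume "u \<notin> k"
  have sf: "subfield k" using k by (simp add: algebraically_closed_subfield_def)
  have "transcendental_over k u"
    using algebraically_closed_root[OF k] \<open>u \<notin> k\<close> by (auto simp: transcendental_over_def)
  then obtain \<epsilon> where \<epsilon>: "\<epsilon> \<in> derivations_killing k" "\<epsilon> u = 1"
    using transcendental_derivation[OF subfieldD(2)[OF sf]] sf
    by (metis subfieldD(4) subfield_diff)
  \<comment> \<open>Correcting \<open>\<epsilon>\<close> by a multiple of \<open>\<delta>\<close>
    makes it kill \<open>f\<close>, hence \<open>u\<close>; but \<open>\<delta> u = 0\<close> leaves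
    the value 1 at \<open>u\<close>.\<close>
  define \<zeta> where "\<zeta> = (\<lambda>v. \<epsilon> v - (\<epsilon> f / \<delta> f) * \<delta> v)"
  have "\<zeta> \<in> derivations_killing k"
    unfolding \<zeta>_def by (intro derivations_killing_diff derivations_killing_scale \<epsilon> \<delta>)
  then have "\<zeta> \<in> derivations_killing (k \<union> {f})"
    using \<delta>(2) by (auto simp: derivations_killing_def \<zeta>_def)
  then have "\<zeta> u = 0" using u(1) by (auto simp: derivation_closure_def)
  with \<epsilon> u(2) show False by (simp add: \<zeta>_def)
qed

text \<open>Were \<open>u\<close> transcendental over \<open>k[f]\<close>, some derivation killing
  \<open>k\<close> and \<open>f\<close> would take the value 1 at \<open>u\<close>. This turns
  membership in the closure into an actual polynomial relation.\<close>

lemma closure_algebraic: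
  fixes f :: "'a::field_char_0"
  assumes k: "subfield k" and u: "u \<in> derivation_closure (k \<union> {f})"
  shows "\<not> transcendental_over {v. in_poly_ring k f v} u"
proof
  define R where "R = {v. in_poly_ring k f v}"
  assume "transcendental_over {v. in_poly_ring k f v} u"
  then have tr: "transcendental_over R u" by (simp add: R_def)
  have mem: "poly p f \<in> R" if "poly_over k p" for p
    using that by (auto simp: R_def in_poly_ring_def)
  have kR: "a \<in> R" if "a \<in> k" for a
    using mem[OF poly_over_monom[OF k that, of 0]] by (simp add: monom_0)
  have ring: "a - b \<in> R \<and> a * b \<in> R" if ab: "a \<in> R" "b \<in> R" for a b
  proof -
    obtain p q where "poly_over k p" "poly_over k q" "a = poly p f" "b = poly q f"
      using ab by (auto simp: R_def in_poly_ring_def)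
    then show ?thesis
      using mem[OF poly_over_diff[OF k, of p q]] mem[OF poly_over_mult[OF k, of p q]] by simp
  qed
  obtain \<epsilon> where "\<epsilon> \<in> derivations_killing R" "\<epsilon> u = 1"
    using transcendental_derivation[OF kR[OF subfieldD(2)[OF k]] ring tr] by blast
  moreover have "f \<in> R"
    using mem[OF poly_over_monom[OF k subfieldD(2)[OF k], of 1]] by (simp add: poly_monom)
  ultimately show False
    using u kR by (auto simp: derivation_closure_def derivations_killing_def)
qed

text \<open>Comparing the extreme coefficients \<open>a\<^sub>n, a\<^sub>0 \<in> k[f]\<close> of a minimal relation for \<open>u\<close> gives
  \<open>a\<^sub>n \<delta> a\<^sub>0 - a\<^sub>0 \<delta> a\<^sub>n = n r a\<^sub>n a\<^sub>0\<close>, where the left side has smaller degree in \<open>f\<close>.\<close>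

lemma closure_eigenvector:
  fixes f :: "'a::field_char_0"
  assumes k: "subfield k" and f: "transcendental_over k f"
    and \<delta>: "\<delta> \<in> derivations_killing k" "\<delta> f \<in> k"
    and u: "u \<in> derivation_closure (k \<union> {f})" "\<delta> u = r * u" and r: "r \<in> k" "r \<noteq> 0"
  shows "u = 0"
proof (rule ccontr)
  assume "u \<noteq> 0"
  define R where "R = {v. in_poly_ring k f v}"
  define Q where "Q = (\<lambda>p. poly_over R p \<and> p \<noteq> 0 \<and> poly p u = 0)"
  have d: "derivation \<delta>" using \<delta> by (simp add: derivations_killing_def)
  have mem: "poly p f \<in> R" if "poly_over k p" for p
    using that by (auto simp: R_def in_poly_ring_def)
  have "\<exists>p. Q p"
    using closure_algebraic[OF k u(1)] by (auto simp: transcendental_over_def Q_def R_def)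
  define p where "p = arg_min degree Q"
  have "Q p"
    unfolding p_def using \<open>\<exists>p. Q p\<close> by (metis arg_min_natI)
  then have p: "poly_over R p" "p \<noteq> 0" "poly p u = 0" by (auto simp: Q_def)
  have min: "s = 0" if "poly_over R s" "poly s u = 0" "degree s < degree p" for s
    using arg_min_nat_le[of Q s degree] that unfolding p_def by (auto simp: Q_def)
  define n where "n = degree p"
  have "n > 0"
    unfolding n_def by (rule ccontr) (use p in \<open>auto elim!: degree_eq_zeroE\<close>)
  have p0: "coeff p 0 \<noteq> 0"
  proof
    assume "coeff p 0 = 0"
    then obtain s where s: "p = pCons 0 s" by (metis coeff_pCons_0 pCons_cases)
    have "poly_over R s"
      using p(1) unfolding poly_over_def s by (metis coeff_pCons_Suc)
    moreover have "poly s u = 0" "degree s < degree p"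
      using p \<open>u \<noteq> 0\<close> by (auto simp: s)
    ultimately have "s = 0" using min by blast
    then show False using p(2) s by simp
  qed
  have "\<exists>a. poly_over k a \<and> coeff p i = poly a f" for i
  proof -
    have "coeff p i \<in> R" using p(1) by (simp add: poly_over_def)
    then show ?thesis by (simp add: R_def in_poly_ring_def)
  qed
  then have "\<exists>a. \<forall>i. poly_over k (a i) \<and> coeff p i = poly (a i) f"
    by (intro choice allI)
  then obtain a where a: "\<And>i. poly_over k (a i)" "\<And>i. coeff p i = poly (a i) f"
    by blast
  \<comment> \<open>\<open>b i\<close> represents the coefficient of \<open>u ^ i\<close> in
    \<open>\<delta> (poly p u)\<close>: since \<open>\<delta> u = r * u\<close>, differentiating
    \<open>u ^ i\<close> multiplies it by \<open>of_nat i * r\<close>.\<close>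
  define b where "b = (\<lambda>i. smult (\<delta> f) (pderiv (a i)) + smult (of_nat i * r) (a i))"
  have b: "poly_over k (b i)" for i
    unfolding b_def
    by (intro poly_over_add poly_over_smult poly_over_pderiv k \<delta> r a subfieldD subfield_of_nat)
  define q where "q = map_poly \<delta> p + smult r (pCons 0 (pderiv p))"
  have q: "coeff q i = poly (b i) f" for i
    by (cases i) (simp_all add: q_def b_def coeff_map_poly derivation_0[OF d] a
        derivations_killing_poly[OF \<delta>(1)] coeff_pderiv algebra_simps)
  have "poly q u = \<delta> (poly p u)"
    by (simp add: q_def derivation_poly[OF d] u(2) algebra_simps)
  then have qu: "poly q u = 0" by (simp add: p derivation_0[OF d])
  \<comment> \<open>Both \<open>p\<close> and \<open>q\<close> vanish at \<open>u\<close>;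
    eliminating the coefficient at \<open>n\<close> lowers the degree, so minimality gives
    \<open>s = 0\<close>.\<close>
  define s where "s = smult (coeff p n) q - smult (coeff q n) p"
  have s: "coeff s i = poly (a n * b i - b n * a i) f" for i
    by (simp add: s_def a q)
  have "poly_over R s"
    unfolding poly_over_def s by (intro allI mem poly_over_diff poly_over_mult k a b)
  moreover have "poly s u = 0" by (simp add: s_def qu p)
  moreover have "degree s < degree p"
  proof -
    have "coeff s i = 0" if "i \<ge> n" for i
    proof (cases "i = n")
      case False
      then have "coeff p i = 0" "coeff p (Suc (i - 1)) = 0"
        using that by (auto intro!: coeff_eq_0 simp: n_def)
      moreover have "coeff q i = 0"
        using calculation False that by (cases i) (simp_all add: q_def coeff_map_poly derivation_0[OF d] coeff_pderiv)
      ultimately show ?thesis by (simp add: s_def)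
    qed (simp add: s_def)
    then have "degree s \<le> n - 1"
      by (intro degree_le) auto
    then show ?thesis using \<open>n > 0\<close> by (simp add: n_def)
  qed
  ultimately have "s = 0" by (rule min)
  then have "poly (a n * b 0 - b n * a 0) f = 0"
    using s[of 0] by simp
  moreover have "poly_over k (a n * b 0 - b n * a 0)"
    by (intro poly_over_diff poly_over_mult k a b)
  ultimately have "a n * b 0 - b n * a 0 = 0"
    using f unfolding transcendental_over_def by blast
  then have "smult (\<delta> f) (a n * pderiv (a 0) - a 0 * pderiv (a n)) = smult (of_nat n * r) (a n * a 0)"
    by (simp add: b_def algebra_simps smult_diff_right)
  \<comment> \<open>In this position the right side shows the leading coefficients, while the left
    side has none because \<open>pderiv\<close> lowers degrees.\<close>
  then have "coeff (smult (\<delta> f) (a n * pderiv (a 0) - a 0 * pderiv (a n))) (degree (a n) + degree (a 0))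
      = of_nat n * r * (lead_coeff (a n) * lead_coeff (a 0))"
    by (simp add: coeff_mult_degree_sum)
  moreover have "coeff (c * pderiv e) (degree c + degree e) = 0" for c e :: "'a poly"
  proof (cases "degree e = 0")
    case True
    then have "pderiv e = 0" by (simp add: pderiv_eq_0_iff)
    then show ?thesis by simp
  next
    case False
    then show ?thesis
      by (intro coeff_eq_0 le_less_trans[OF degree_mult_le]) (simp add: degree_pderiv)
  qed
  from this[of "a n" "a 0"] this[of "a 0" "a n"]
  have "coeff (smult (\<delta> f) (a n * pderiv (a 0) - a 0 * pderiv (a n))) (degree (a n) + degree (a 0)) = 0"
    by (simp add: add.commute)
  ultimately have "a n = 0 \<or> a 0 = 0"
    using \<open>n > 0\<close> r by simp
  moreover have "coeff p n \<noteq> 0" using p by (simp add: n_def)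
  ultimately show False using p0 a(2)[of n] a(2)[of 0] by auto
qed

section \<open>First-order equations in k[f] and polynomials in \<delta>\<close>

lemma first_order_polynomial_solution:
  fixes \<beta> r :: "'a::field_char_0"
  assumes k: "subfield k" and \<beta>: "\<beta> \<in> k" "\<beta> \<noteq> 0" and r: "r \<in> k" and p: "poly_over k p"
  obtains q where "poly_over k q" "smult \<beta> (pderiv q) - smult r q = p"
proof -
  have "\<exists>q. poly_over k q \<and> smult \<beta> (pderiv q) - smult r q = p"
    if "\<forall>i\<ge>n. coeff p i = 0" "poly_over k p" for n p
    using that
  proof (induction n arbitrary: p)
    case 0
    then have "p = 0" by (simp add: poly_eq_iff)
    then show ?case by (intro exI[of _ 0]) (simp add: poly_over_def subfieldD[OF k])
  next
    case (Suc n)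
    have pn: "coeff p n \<in> k" using Suc.prems(2) by (simp add: poly_over_def)
    \<comment> \<open>One monomial matches the coefficient at \<open>n\<close>: by integration if
      \<open>r = 0\<close>, otherwise through \<open>r * q\<close>, the derivative then affecting
      only lower degrees.\<close>
    define q where "q = (if r = 0 then monom (coeff p n / (of_nat (Suc n) * \<beta>)) (Suc n)
      else monom (- coeff p n / r) n)"
    have q: "poly_over k q"
      unfolding q_def using pn \<beta> r
      by (auto intro!: poly_over_monom subfield_divide subfieldD subfield_of_nat k simp del: of_nat_Suc)
    define s where "s = p - (smult \<beta> (pderiv q) - smult r q)"
    have "coeff s i = 0" if "i \<ge> n" for i
    proof (cases "i = n")
      case True
      then show ?thesis
        using \<beta>(2) by (simp add: s_def q_def coeff_pderiv del: of_nat_Suc)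
    next
      case False
      with that Suc.prems(1) show ?thesis
        by (auto simp: s_def q_def coeff_pderiv simp del: of_nat_Suc)
    qed
    moreover have "poly_over k s"
      unfolding s_def
      by (intro poly_over_diff poly_over_smult poly_over_pderiv k \<beta> r q Suc.prems)
    ultimately obtain t where t: "poly_over k t" "smult \<beta> (pderiv t) - smult r t = s"
      using Suc.IH[of s] by blast
    have "smult \<beta> (pderiv (q + t)) - smult r (q + t)
        = (smult \<beta> (pderiv q) - smult r q) + (smult \<beta> (pderiv t) - smult r t)"
      by (simp add: pderiv_add smult_add_right)
    also have "\<dots> = p" unfolding t s_def by simp
    finally show ?case using poly_over_add[OF k q t(1)] by blast
  qed
  from this[of "Suc (degree p)" p] show ?thesis
    using p that by (auto simp: coeff_eq_0)
qed

definition poly_operator :: "('a::comm_ring_1 \<Rightarrow> 'a) \<Rightarrow> 'a poly \<Rightarrow> 'a \<Rightarrow> 'a" where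
  "poly_operator \<delta> p y = (\<Sum>i\<le>degree p. coeff p i * (\<delta> ^^ i) y)"

lemma poly_operator_bound:
  assumes "degree p \<le> n"
  shows "poly_operator \<delta> p y = (\<Sum>i\<le>n. coeff p i * (\<delta> ^^ i) y)"
  unfolding poly_operator_def using assms
  by (intro sum.mono_neutral_left) (auto simp: coeff_eq_0)

lemma funpow_linear:
  assumes \<delta>: "\<delta> \<in> derivations_killing k" and c: "\<And>j. j \<in> A \<Longrightarrow> c j \<in> k"
  shows "(\<delta> ^^ i) (\<Sum>j\<in>A. c j * F j) = (\<Sum>j\<in>A. c j * (\<delta> ^^ i) (F j))"
  using assms
  by (induction i)
    (simp_all add: derivations_killing_def derivation_sum derivation_mult)

text \<open>As \<open>\<delta>\<close> kills \<open>r\<close>, multiplication by \<open>r\<close>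
  commutes with \<open>\<delta>\<close>, so the linear factor may act first.\<close>

lemma poly_operator_linear_factor:
  assumes k: "subfield k" and \<delta>: "\<delta> \<in> derivations_killing k" and r: "r \<in> k"
  shows "poly_operator \<delta> ([:- r, 1:] * q) y = poly_operator \<delta> q (\<delta> y - r * y)"
proof -
  let ?n = "degree q"
  have d: "derivation \<delta>" using \<delta> by (simp add: derivations_killing_def)
  have pow: "(\<delta> ^^ i) (\<delta> y - r * y) = (\<delta> ^^ Suc i) y - r * (\<delta> ^^ i) y" for i
  proof (induction i)
    case (Suc i)
    then show ?case
      using \<delta> r by (simp add: derivation_diff[OF d] derivation_mult[OF d]) (simp add: derivations_killing_def)
  qed simp
  have eq: "[:- r, 1:] * q = pCons 0 q - smult r q" by simp
  have "degree ([:- r, 1:] * q) \<le> Suc ?n"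
    by (rule order.trans[OF degree_mult_le]) simp
  then have "poly_operator \<delta> ([:- r, 1:] * q) y
      = (\<Sum>i\<le>Suc ?n. coeff (pCons 0 q) i * (\<delta> ^^ i) y) - (\<Sum>i\<le>Suc ?n. r * coeff q i * (\<delta> ^^ i) y)"
    unfolding eq[symmetric] by (simp only: poly_operator_bound) (simp only: eq coeff_diff coeff_smult left_diff_distrib sum_subtractf)
  also have "(\<Sum>i\<le>Suc ?n. coeff (pCons 0 q) i * (\<delta> ^^ i) y) = (\<Sum>i\<le>?n. coeff q i * (\<delta> ^^ Suc i) y)"
    by (simp only: sum.atMost_Suc_shift coeff_pCons_Suc coeff_pCons_0) simp
  also have "(\<Sum>i\<le>Suc ?n. r * coeff q i * (\<delta> ^^ i) y) = (\<Sum>i\<le>?n. r * coeff q i * (\<delta> ^^ i) y)"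
    by (simp add: coeff_eq_0)
  also have "(\<Sum>i\<le>?n. coeff q i * (\<delta> ^^ Suc i) y) - (\<Sum>i\<le>?n. r * coeff q i * (\<delta> ^^ i) y)
      = poly_operator \<delta> q (\<delta> y - r * y)"
    unfolding poly_operator_def pow sum_subtractf[symmetric] by (simp add: algebra_simps)
  finally show ?thesis .
qed

text \<open>Split off a factor with root \<open>r\<close>. By induction
  \<open>\<delta> y - r * y\<close> lies in \<open>k[f]\<close>. Subtracting from \<open>y\<close>
  an element of \<open>k[f]\<close> with the same image leaves an element that
  \<open>\<delta>\<close> multiplies by \<open>r\<close>, and such an element of the closure lies in
  \<open>k\<close>.\<close>

lemma in_poly_ring_if_constant_coeff_ode:
  fixes f :: "'a::field_char_0"
  assumes ac: "algebraically_closed_subfield k" and f: "transcendental_over k f"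
    and \<delta>: "\<delta> \<in> derivations_killing k" "\<delta> f \<in> k" "\<delta> f \<noteq> 0"
  shows "poly_over k p \<Longrightarrow> p \<noteq> 0 \<Longrightarrow> y \<in> derivation_closure (k \<union> {f}) \<Longrightarrow>
    poly_operator \<delta> p y = 0 \<Longrightarrow> in_poly_ring k f y"
proof (induction "degree p" arbitrary: p y)
  case 0
  have k: "subfield k" using ac by (simp add: algebraically_closed_subfield_def)
  obtain c where "p = [:c:]" using 0 by (metis degree_eq_zeroE)
  then have "y = poly 0 f" using 0 by (simp add: poly_operator_def)
  moreover have "poly_over k 0" by (simp add: poly_over_def subfieldD[OF k])
  ultimately show ?case unfolding in_poly_ring_def by blast
next
  case (Suc n)
  let ?E = "derivation_closure (k \<union> {f})"
  have k: "subfield k" using ac by (simp add: algebraically_closed_subfield_def)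
  have d: "derivation \<delta>" and \<delta>k: "\<And>a. a \<in> k \<Longrightarrow> \<delta> a = 0"
    using \<delta> by (auto simp: derivations_killing_def)
  obtain r q where rq: "r \<in> k" "p = [:- r, 1:] * q" "poly_over k q" "degree q = n"
    using algebraically_closed_factor[OF ac Suc.prems(1)] Suc.hyps(2) by metis
  have kE: "k \<subseteq> ?E" using derivation_closure_superset[of "k \<union> {f}"] by simp
  have "\<delta> y \<in> ?E"
  proof (rule derivation_closure_stable[OF d _ Suc.prems(3)])
    fix a assume "a \<in> k \<union> {f}"
    then have "\<delta> a \<in> k" using \<delta>k \<delta>(2) subfieldD(1)[OF k] by auto
    then show "\<delta> a \<in> ?E" using kE by blast
  qed
  then have "\<delta> y - r * y \<in> ?E"
    using kE rq(1) Suc.prems(3) by (intro derivation_closure_ring) auto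
  moreover have "poly_operator \<delta> q (\<delta> y - r * y) = 0"
    using Suc.prems(4) poly_operator_linear_factor[OF k \<delta>(1) rq(1)] rq(2) by simp
  ultimately have "in_poly_ring k f (\<delta> y - r * y)"
    using Suc.hyps(1)[OF rq(4)[symmetric] rq(3)] rq(2) Suc.prems(2) by (metis mult_zero_right)
  then obtain s where s: "poly_over k s" "\<delta> y - r * y = poly s f"
    by (auto simp: in_poly_ring_def)
  obtain t where t: "poly_over k t" "smult (\<delta> f) (pderiv t) - smult r t = s"
    using first_order_polynomial_solution[OF k \<delta>(2,3) rq(1) s(1)] .
  define u where "u = y - poly t f"
  have u: "u \<in> ?E"
    unfolding u_def by (intro derivation_closure_ring Suc.prems poly_in_derivation_closure t)
  have "\<delta> u - r * u = poly s f - poly (smult (\<delta> f) (pderiv t) - smult r t) f"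
    using s(2) by (simp add: u_def derivation_diff[OF d] derivations_killing_poly[OF \<delta>(1) t(1)] algebra_simps)
  then have \<delta>u: "\<delta> u = r * u" by (simp add: t(2))
  have "u \<in> k"
  proof (cases "r = 0")
    case True
    then show ?thesis using closure_constant[OF ac \<delta>(1,3) u] \<delta>u by simp
  next
    case False
    then have "u = 0" using closure_eigenvector[OF k f \<delta>(1,2) u \<delta>u rq(1)] by simp
    then show ?thesis using subfieldD(1)[OF k] by simp
  qed
  then have "poly_over k (monom u 0 + t)"
    by (intro poly_over_add poly_over_monom k t)
  moreover have "y = poly (monom u 0 + t) f"
    by (simp add: u_def poly_monom)
  ultimately show ?case unfolding in_poly_ring_def by blast
qed

section \<open>A constant-coefficient equation in \<delta> for g, and the conclusion\<close>

lemma iterated_commute: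
  assumes "\<And>u. u \<in> Z \<Longrightarrow> D u \<in> Z" "\<And>u. u \<in> Z \<Longrightarrow> \<delta> u \<in> Z" "\<And>u. u \<in> Z \<Longrightarrow> D (\<delta> u) = \<delta> (D u)"
    and "u \<in> Z"
  shows "(D ^^ j) ((\<delta> ^^ i) u) = (\<delta> ^^ i) ((D ^^ j) u)"
proof -
  have \<delta>Z: "(\<delta> ^^ i) u \<in> Z" if "u \<in> Z" for i u
    using that by (induction i) (simp_all add: assms)
  have DZ: "(D ^^ j) u \<in> Z" for j
    using assms(4) by (induction j) (simp_all add: assms)
  have one: "D ((\<delta> ^^ i) u) = (\<delta> ^^ i) (D u)" if "u \<in> Z" for i u
    using that by (induction i) (simp_all add: assms \<delta>Z)
  show ?thesis
    by (induction j) (simp_all add: one DZ)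
qed

theorem theorem28:
  fixes D :: "'a::field_char_0 \<Rightarrow> 'a" and k :: "'a set" and f g x :: 'a
  assumes "derivation D"
    and "differential_subfield D k"
    and "algebraically_closed_subfield k"
    and "constants D \<subseteq> k"
    and "f \<noteq> 0"
    and "iterated_integral D k f"
    and "satisfies_lin_ode D k g"
    and "x \<in> k" and "D x = 1"
    and "transcendental_over k f"
    and "algebraically_dependent_over k f g"
  shows "in_poly_ring k f g"
proof -
  note D = assms(1) and f = \<open>transcendental_over k f\<close>
  have k: "subfield k" using assms(2) by (simp add: differential_subfield_def)
  obtain \<delta> Z where \<delta>: "\<delta> \<in> derivations_killing k" "\<delta> f \<in> k" "\<delta> f \<noteq> 0"
    and EZ: "derivation_closure (k \<union> {f}) \<subseteq> Z"
    and Z: "\<And>u. u \<in> Z \<Longrightarrow> D u \<in> Z" "\<And>u. u \<in> Z \<Longrightarrow> \<delta> u \<in> Z" "\<And>u. u \<in> Z \<Longrightarrow> D (\<delta> u) = \<delta> (D u)"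
    using commuting_derivation[OF D assms(2,4,6) f assms(8,9)] by metis
  have g: "g \<in> derivation_closure (k \<union> {f})"
    by (rule algebraically_dependent_in_closure[OF k f assms(11)])
  obtain n a where a: "\<And>i. i \<le> n \<Longrightarrow> a i \<in> k" "\<exists>i\<le>n. a i \<noteq> 0" "(\<Sum>i\<le>n. a i * (D ^^ i) g) = 0"
    using assms(7) by (auto simp: satisfies_lin_ode_def)
  \<comment> \<open>The equation is cut off at its last nonzero coefficient, because the dependence
    argument divides by it.\<close>
  define B where "B = {i. i \<le> n \<and> a i \<noteq> 0}"
  define N where "N = Max B"
  have B: "finite B" "B \<noteq> {}" using a(2) by (auto simp: B_def)
  have N: "N \<le> n" "a N \<noteq> 0"
    using Max_in[OF B] unfolding N_def[symmetric] by (auto simp: B_def)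
  have above: "a i = 0" if "N < i" "i \<le> n" for i
  proof -
    have "i \<notin> B" using Max_ge[OF B(1), of i] that(1) by (auto simp: N_def)
    then show ?thesis using that(2) by (simp add: B_def)
  qed
  have ode: "(\<Sum>j\<le>N. a j * (D ^^ j) g) = 0"
    unfolding a(3)[symmetric] using N(1) above by (intro sum.mono_neutral_left) auto
  \<comment> \<open>On \<open>Z\<close> the derivations commute, and \<open>\<delta>\<close> is
    linear over the coefficients in \<open>k\<close>; so it preserves solutions.\<close>
  have odes: "(\<Sum>j\<le>N. a j * (D ^^ j) ((\<delta> ^^ i) g)) = 0" for i
  proof -
    have "(\<Sum>j\<le>N. a j * (D ^^ j) ((\<delta> ^^ i) g)) = (\<Sum>j\<le>N. a j * (\<delta> ^^ i) ((D ^^ j) g))"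
      using iterated_commute[where Z = Z and D = D and \<delta> = \<delta> and u = g] Z g EZ by (simp add: subset_iff)
    also have "\<dots> = (\<delta> ^^ i) (\<Sum>j\<le>N. a j * (D ^^ j) g)"
      using a(1) N(1) by (intro funpow_linear[OF \<delta>(1), symmetric]) auto
    also have "\<dots> = 0"
      unfolding ode using \<delta>(1)
      by (induction i) (simp_all add: derivations_killing_def derivation_0)
    finally show ?thesis .
  qed
  obtain m c where c: "\<And>i. i < m \<Longrightarrow> D (c i) = 0" "(\<delta> ^^ m) g = (\<Sum>i<m. c i * (\<delta> ^^ i) g)"
    using ode_solutions_dependent[where y = "\<lambda>i. (\<delta> ^^ i) g", OF D _ odes] N(2) by blast
  \<comment> \<open>The dependence among the iterates becomes an operator \<open>p\<close> in
    \<open>\<delta>\<close> annihilating \<open>g\<close>; its coefficients are constants, hence in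
    \<open>k\<close>, and the coefficient 1 at \<open>m\<close> makes it nonzero.\<close>
  define s where "s = (\<Sum>i<m. monom (c i) i)"
  define p where "p = monom 1 m - s"
  have s: "coeff s i = (if i < m then c i else 0)" for i
    by (simp add: s_def coeff_sum coeff_monom)
  have "poly_over k p"
    unfolding p_def s_def using c(1) assms(4)
    by (intro poly_over_diff poly_over_sum poly_over_monom k subfieldD) (auto simp: constants_def)
  moreover have "coeff p m = 1" by (simp add: p_def s)
  then have "p \<noteq> 0" by auto
  moreover have "degree p \<le> m" by (rule degree_le) (simp add: p_def s)
  then have "poly_operator \<delta> p g = (\<Sum>i\<le>m. coeff p i * (\<delta> ^^ i) g)"
    by (rule poly_operator_bound)
  then have "poly_operator \<delta> p g = 0"
    by (simp add: lessThan_Suc_atMost[symmetric] c(2) p_def s sum_negf)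
  ultimately show ?thesis
    using in_poly_ring_if_constant_coeff_ode[OF assms(3) f \<delta>] g by blast
qed

end
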